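(* Let $\varphi$ and $\psi$ be analytic self-maps of $\mathbb{D}$ such that the composition operators $C_\varphi$ and $C_\psi$ are bounded on $S^2$, and let $$\rho(z)=\left|\frac{\varphi(z)-\psi(z)}{1-\overline{\varphi(z)}\psi(z)}\right|,\qquad z\in\mathbb{D}.$$ If $C_\varphi-C_\psi$ is compact on $S^2$, then $$\lim_{|z|\to1}\rho(z)\left(\frac{|\varphi'(z)|^2(1-|z|^2)}{1-|\varphi(z)|^2}+\frac{|\psi'(z)|^2(1-|z|^2)}{1-|\psi(z)|^2}\right)=0.$$
   Context: $\mathbb{D}=\{z\in\mathbb{C}:|z|<1\}$. For an analytic self-map $\varphi$ of $\mathbb{D}$, the composition operator is $C_\varphi f=f\circ\varphi$. The space $S^2$ is the Hilbert space of analytic functions $f(z)=\sum_{n\ge0}a_nz^n$ on $\mathbb{D}$ with $\|f\|_{S^2}^2=|f(0)|^2+\|f'\|_{H^2}^2=|a_0|^2+\sum_{n=1}^\infty n^2|a_n|^2<\infty$, where $H^2$ is the Hardy space on $\mathbb{D}$. *)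

theory Defs
  imports "HOL-Complex_Analysis.Complex_Analysis"
begin

abbreviation unit_disc :: "complex set" where
  "unit_disc \<equiv> ball 0 1"

definition analytic_self_map :: "(complex \<Rightarrow> complex) \<Rightarrow> bool" where
  "analytic_self_map \<phi> \<longleftrightarrow> \<phi> holomorphic_on unit_disc \<and> \<phi> ` unit_disc \<subseteq> unit_disc"

definition taylor_coeff :: "(complex \<Rightarrow> complex) \<Rightarrow> nat \<Rightarrow> complex" where
  "taylor_coeff f n = fps_nth (fps_expansion f 0) n"

text \<open>
  Elements of the space are represented by total functions whose values outside the unit disc
  are irrelevant: membership, norm and the operators below depend only on values in the disc.
\<close>

definition S2 :: "(complex \<Rightarrow> complex) set" where
  "S2 = {f. f holomorphic_on unit_disc \<and>
            summable (\<lambda>n. (real n)\<^sup>2 * (cmod (taylor_coeff f n))\<^sup>2)}"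

text \<open>The term of index 0 in the series vanishes. The value is meaningful only for \<open>f \<in> S2\<close>.\<close>

definition S2_norm :: "(complex \<Rightarrow> complex) \<Rightarrow> real" where
  "S2_norm f = sqrt ((cmod (f 0))\<^sup>2 + (\<Sum>n. (real n)\<^sup>2 * (cmod (taylor_coeff f n))\<^sup>2))"

definition comp_op :: "(complex \<Rightarrow> complex) \<Rightarrow> (complex \<Rightarrow> complex) \<Rightarrow> complex \<Rightarrow> complex" where
  "comp_op \<phi> f = (\<lambda>z. f (\<phi> z))"

text \<open>
  The next two predicates are meant for operators that are linear by construction, such as
  composition operators and their differences; linearity is therefore not part of them.
\<close>

definition bounded_on_S2 :: "((complex \<Rightarrow> complex) \<Rightarrow> complex \<Rightarrow> complex) \<Rightarrow> bool" where
  "bounded_on_S2 T \<longleftrightarrow>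
     (\<forall>f\<in>S2. T f \<in> S2) \<and> (\<exists>C. \<forall>f\<in>S2. S2_norm (T f) \<le> C * S2_norm f)"

text \<open>Every bounded sequence has a subsequence whose image converges in the norm of the space.\<close>

definition compact_on_S2 :: "((complex \<Rightarrow> complex) \<Rightarrow> complex \<Rightarrow> complex) \<Rightarrow> bool" where
  "compact_on_S2 T \<longleftrightarrow>
     (\<forall>f\<in>S2. T f \<in> S2) \<and>
     (\<forall>F :: nat \<Rightarrow> complex \<Rightarrow> complex.
        (\<forall>n. F n \<in> S2) \<and> (\<exists>B. \<forall>n. S2_norm (F n) \<le> B) \<longrightarrow>
        (\<exists>g\<in>S2. \<exists>r :: nat \<Rightarrow> nat. strict_mono r \<and>
           (\<lambda>k. S2_norm (\<lambda>z. T (F (r k)) z - g z)) \<longlonglongrightarrow> 0))"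

definition pseudohyperbolic_dist :: "complex \<Rightarrow> complex \<Rightarrow> real" where
  "pseudohyperbolic_dist a b = cmod ((a - b) / (1 - cnj a * b))"

end

theory Submission
  imports Defs
begin

text \<open>
  Let \<open>X = \<bar>\<phi>'(z)\<bar> ((1 - \<bar>z\<bar>\<^sup>2) / (1 - \<bar>\<phi>(z)\<bar>\<^sup>2))\<^bsup>1/2\<^esup>\<close>, let \<open>Y\<close> be the same quantity for
  \<open>\<psi>\<close>, and put \<open>s = (1 - \<rho>\<^sup>2)\<^bsup>1/2\<^esup>\<close>. Any \<open>f\<close> in the space satisfies
  \<open>\<bar>f'(z)\<bar> (1 - \<bar>z\<bar>\<^sup>2)\<^bsup>1/2\<^esup> \<le> \<parallel>f\<parallel>\<close>, and the left side tends to \<open>0\<close> at the boundary; hence for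
  compact \<open>T\<close> the quantity \<open>\<bar>(T f\<^sub>z)'(z)\<bar> (1 - \<bar>z\<bar>\<^sup>2)\<^bsup>1/2\<^esup>\<close> tends to \<open>0\<close> for every bounded
  family \<open>f\<^sub>z\<close>. Taking for \<open>f\<^sub>z\<close> the primitive of the normalised Hardy space kernel at
  \<open>\<phi>(z)\<close>, respectively \<open>\<psi>(z)\<close>, gives \<open>X - s Y \<rightarrow> 0\<close> and \<open>Y - s X \<rightarrow> 0\<close>. Therefore
  \<open>\<rho>\<^sup>2 X = (X - s Y) + s (Y - s X) \<rightarrow> 0\<close>, and since \<open>X\<close> is bounded by boundedness of the
  composition operator, \<open>\<rho>\<^sup>2 X\<^sup>4 \<rightarrow> 0\<close>, that is \<open>\<rho> X\<^sup>2 \<rightarrow> 0\<close>.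
\<close>

section \<open>Cauchy-Schwarz for series and pointwise bounds for power series\<close>

lemma Cauchy_Schwarz_suminf:
  fixes a b :: "nat \<Rightarrow> real"
  assumes a: "summable (\<lambda>n. (a n)\<^sup>2)" and b: "summable (\<lambda>n. (b n)\<^sup>2)"
    and nonneg: "\<And>n. 0 \<le> a n" "\<And>n. 0 \<le> b n"
  shows "summable (\<lambda>n. a n * b n)"
    and "(\<Sum>n. a n * b n)\<^sup>2 \<le> (\<Sum>n. (a n)\<^sup>2) * (\<Sum>n. (b n)\<^sup>2)"
proof -
  have "norm (a n * b n) \<le> (a n)\<^sup>2 + (b n)\<^sup>2" for n
    using sum_squares_bound[of "a n" "b n"] mult_nonneg_nonneg[OF nonneg[of n]] by simp
  then show ab: "summable (\<lambda>n. a n * b n)"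
    by (intro summable_comparison_test'[OF summable_add[OF a b], of 0]) auto
  have "(\<Sum>n<N. a n * b n)\<^sup>2 \<le> (\<Sum>n. (a n)\<^sup>2) * (\<Sum>n. (b n)\<^sup>2)" for N
    by (intro order_trans[OF Cauchy_Schwarz_ineq_sum] mult_mono sum_le_suminf a b)
       (auto intro!: sum_nonneg suminf_nonneg a b)
  then show "(\<Sum>n. a n * b n)\<^sup>2 \<le> (\<Sum>n. (a n)\<^sup>2) * (\<Sum>n. (b n)\<^sup>2)"
    by (intro LIMSEQ_le_const2[OF tendsto_power[OF summable_LIMSEQ[OF ab]]]) auto
qed

text \<open>Cauchy-Schwarz against the sequence \<open>cmod z ^ n\<close>, whose squares sum to 1/(1
  - |z|^2). This is the bound for point evaluation on the Hardy space.\<close>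

lemma cmod_power_series_le:
  fixes c :: "nat \<Rightarrow> complex" and z :: complex
  assumes c: "summable (\<lambda>n. (cmod (c n))\<^sup>2)" and z: "cmod z < 1"
  shows "summable (\<lambda>n. c n * z ^ n)"
    and "(cmod (\<Sum>n. c n * z ^ n))\<^sup>2 * (1 - (cmod z)\<^sup>2) \<le> (\<Sum>n. (cmod (c n))\<^sup>2)"
proof -
  have z2: "(cmod z)\<^sup>2 < 1"
    using z by (simp add: abs_square_less_1)
  have pow: "((cmod z) ^ n)\<^sup>2 = ((cmod z)\<^sup>2) ^ n" for n
    by (simp add: power_mult [symmetric] mult.commute)
  have g: "(\<lambda>n. ((cmod z) ^ n)\<^sup>2) sums (1 / (1 - (cmod z)\<^sup>2))"
    unfolding pow using z2 by (intro geometric_sums) simp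
  note CS = Cauchy_Schwarz_suminf[OF c sums_summable[OF g] norm_ge_zero zero_le_power[OF norm_ge_zero]]
  have n: "cmod (c n * z ^ n) = cmod (c n) * cmod z ^ n" for n
    by (simp add: norm_mult norm_power)
  show s: "summable (\<lambda>n. c n * z ^ n)"
    by (rule summable_norm_cancel) (simp add: n CS(1))
  have "(cmod (\<Sum>n. c n * z ^ n))\<^sup>2 \<le> (\<Sum>n. cmod (c n) * cmod z ^ n)\<^sup>2"
    using norm_suminf_le[OF _ CS(1), of "\<lambda>n. c n * z ^ n"] n by (intro power_mono) auto
  also have "\<dots> \<le> (\<Sum>n. (cmod (c n))\<^sup>2) * (1 / (1 - (cmod z)\<^sup>2))"
    using CS(2) sums_unique[OF g] by simp
  finally show "(cmod (\<Sum>n. c n * z ^ n))\<^sup>2 * (1 - (cmod z)\<^sup>2) \<le> (\<Sum>n. (cmod (c n))\<^sup>2)"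
    using z2 by (simp add: field_simps)
qed

section \<open>Growth and boundary decay of derivatives of functions in \<open>S2\<close>\<close>

text \<open>The numbers \<open>of_nat (Suc n) * taylor_coeff f (Suc n)\<close> are the Taylor
  coefficients of the derivative, so these facts place it in the Hardy space. The last one is an
  inequality because the term |f(0)|^2 is dropped.\<close>

lemma S2D:
  assumes "f \<in> S2"
  shows "f holomorphic_on unit_disc"
    and "summable (\<lambda>n. (cmod (of_nat (Suc n) * taylor_coeff f (Suc n)))\<^sup>2)"
    and "(\<Sum>n. (cmod (of_nat (Suc n) * taylor_coeff f (Suc n)))\<^sup>2) \<le> (S2_norm f)\<^sup>2"
proof -
  let ?u = "\<lambda>n. (real n)\<^sup>2 * (cmod (taylor_coeff f n))\<^sup>2"
  show "f holomorphic_on unit_disc" and s: "summable (\<lambda>n. (cmod (of_nat (Suc n) * taylor_coeff f (Suc n)))\<^sup>2)"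
    using assms summable_Suc_iff[of ?u] by (simp_all add: S2_def norm_mult power_mult_distrib del: of_nat_Suc)
  have "(\<Sum>n. (cmod (of_nat (Suc n) * taylor_coeff f (Suc n)))\<^sup>2) = (\<Sum>n. ?u n)"
    using suminf_split_head[of ?u] assms
    by (simp add: S2_def norm_mult power_mult_distrib del: of_nat_Suc)
  also have "\<dots> \<le> (S2_norm f)\<^sup>2"
    using assms unfolding S2_norm_def S2_def by (subst real_sqrt_pow2) (auto intro!: add_nonneg_nonneg suminf_nonneg)
  finally show "(\<Sum>n. (cmod (of_nat (Suc n) * taylor_coeff f (Suc n)))\<^sup>2) \<le> (S2_norm f)\<^sup>2" .
qed

lemma taylor_coeff_diff:
  assumes "f holomorphic_on unit_disc" "g holomorphic_on unit_disc"
  shows "taylor_coeff (\<lambda>z. f z - g z) n = taylor_coeff f n - taylor_coeff g n"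
  using higher_deriv_diff[OF assms, of 0 n]
  by (simp add: taylor_coeff_def fps_expansion_def diff_divide_distrib)

text \<open>Compactness yields convergence of norms of differences; the derivative estimate can be
  applied to such a difference only once it is known to lie in \<open>S2\<close>.\<close>

lemma S2_diff:
  assumes "f \<in> S2" "g \<in> S2"
  shows "(\<lambda>z. f z - g z) \<in> S2"
proof -
  let ?a = "\<lambda>n. real n * cmod (taylor_coeff f n)" and ?b = "\<lambda>n. real n * cmod (taylor_coeff g n)"
  have f: "f holomorphic_on unit_disc" "summable (\<lambda>n. (?a n)\<^sup>2)"
    and g: "g holomorphic_on unit_disc" "summable (\<lambda>n. (?b n)\<^sup>2)"
    using assms by (simp_all add: S2_def power_mult_distrib)
  have "norm ((real n * cmod (taylor_coeff f n - taylor_coeff g n))\<^sup>2) \<le> 2 * (?a n)\<^sup>2 + 2 * (?b n)\<^sup>2" for n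
  proof -
    have "(real n * cmod (taylor_coeff f n - taylor_coeff g n))\<^sup>2 \<le> (?a n + ?b n)\<^sup>2"
      by (intro power_mono) (auto simp: distrib_left [symmetric] intro!: mult_left_mono norm_triangle_ineq4)
    also have "\<dots> \<le> 2 * (?a n)\<^sup>2 + 2 * (?b n)\<^sup>2"
      using sum_squares_bound[of "?a n" "?b n"] by (simp add: power2_sum)
    finally show ?thesis by simp
  qed
  then have "summable (\<lambda>n. (real n * cmod (taylor_coeff f n - taylor_coeff g n))\<^sup>2)"
    by (rule summable_comparison_test'[OF summable_add[OF summable_mult[OF f(2)] summable_mult[OF g(2)]]])
  then show ?thesis
    using f(1) g(1) by (simp add: S2_def taylor_coeff_diff power_mult_distrib holomorphic_on_diff)
qed

lemma deriv_sums_taylor_coeff: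
  assumes f: "f holomorphic_on unit_disc" and z: "z \<in> unit_disc"
  shows "(\<lambda>n. of_nat (Suc n) * taylor_coeff f (Suc n) * z ^ n) sums deriv f z"
proof -
  have "(deriv ^^ n) (deriv f) 0 / fact n = of_nat (Suc n) * taylor_coeff f (Suc n)" for n
    by (simp add: taylor_coeff_def fps_expansion_def funpow_Suc_right del: funpow.simps of_nat_Suc)
  then show ?thesis
    using holomorphic_power_series[OF holomorphic_deriv[OF f] z] by simp
qed

text \<open>Hardy space point evaluation, applied to the derivative of \<open>f\<close>.\<close>

lemma S2_deriv_le:
  assumes f: "f \<in> S2" and z: "z \<in> unit_disc"
  shows "cmod (deriv f z) * sqrt (1 - (cmod z)\<^sup>2) \<le> S2_norm f"
proof (rule power2_le_imp_le)
  have z1: "cmod z < 1" using z by simp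
  show "0 \<le> S2_norm f"
    using f unfolding S2_norm_def S2_def by (auto intro!: add_nonneg_nonneg suminf_nonneg)
  have "(cmod (deriv f z))\<^sup>2 * (1 - (cmod z)\<^sup>2) \<le> (S2_norm f)\<^sup>2"
    using cmod_power_series_le(2)[OF S2D(2)[OF f] z1] S2D(3)[OF f]
      sums_unique[OF deriv_sums_taylor_coeff[OF S2D(1)[OF f] z]] by simp
  moreover have "(cmod z)\<^sup>2 \<le> 1" using z1 by (simp add: abs_square_le_1)
  ultimately show "(cmod (deriv f z) * sqrt (1 - (cmod z)\<^sup>2))\<^sup>2 \<le> (S2_norm f)\<^sup>2"
    by (simp add: power_mult_distrib)
qed

text \<open>The filter \<open>filtercomap cmod (at_left 1)\<close> expresses that |z| tends to 1
  from inside, so estimates valid only on the disc may be used along it.\<close>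

lemma eventually_at_left_1_disc:
  "eventually (\<lambda>z. z \<in> unit_disc) (filtercomap cmod (at_left 1))"
proof -
  have "eventually (\<lambda>r::real. r < 1) (at_left 1)"
    by (simp add: eventually_at_filter)
  then show ?thesis
    by (rule eventually_mono[OF eventually_filtercomapI]) simp
qed

text \<open>The series of the derivative is cut at \<open>N\<close>. The tail has small Hardy norm,
  so its weighted value is small uniformly in \<open>z\<close>; the head is a polynomial, bounded on
  the disc, and the weight sends it to 0.\<close>

lemma S2_deriv_tendsto_0:
  assumes f: "f \<in> S2"
  shows "((\<lambda>z. cmod (deriv f z) * sqrt (1 - (cmod z)\<^sup>2)) \<longlongrightarrow> 0) (filtercomap cmod (at_left 1))"
    (is "(?L \<longlongrightarrow> 0) ?F")
proof (rule tendstoI)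
  fix e :: real assume e: "e > 0"
  define c where "c n = of_nat (Suc n) * taylor_coeff f (Suc n)" for n
  have c: "summable (\<lambda>n. (cmod (c n))\<^sup>2)"
    using S2D(2)[OF f] by (simp add: c_def)
  have "eventually (\<lambda>N. norm (\<Sum>n. (cmod (c (n + N)))\<^sup>2) < (e/2)\<^sup>2) sequentially"
    using suminf_exist_split[OF _ c, of "(e/2)\<^sup>2"] e by (auto simp: eventually_sequentially)
  then obtain N where "norm (\<Sum>n. (cmod (c (n + N)))\<^sup>2) < (e/2)\<^sup>2"
    using eventually_happens' sequentially_bot by blast
  then have N: "(\<Sum>n. (cmod (c (n + N)))\<^sup>2) < (e/2)\<^sup>2"
    by simp
  define M where "M = (\<Sum>n<N. cmod (c n))"
  have le: "?L z \<le> M * sqrt (1 - (cmod z)\<^sup>2) + e/2" if z: "z \<in> unit_disc" for z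
  proof -
    have z1: "cmod z < 1" using z by simp
    then have z2: "(cmod z)\<^sup>2 \<le> 1" by (simp add: abs_square_le_1)
    have s: "summable (\<lambda>n. c n * z ^ n)"
      by (rule cmod_power_series_le(1)[OF c z1])
    have c': "summable (\<lambda>n. (cmod (c (n + N)))\<^sup>2)"
      using c by (rule summable_ignore_initial_segment)
    define T where "T = (\<Sum>n. c (n + N) * z ^ n)"
    have "deriv f z = (\<Sum>n. c n * z ^ n)"
      using sums_unique[OF deriv_sums_taylor_coeff[OF S2D(1)[OF f] z]] by (simp add: c_def)
    also have "\<dots> = (\<Sum>n. c (n + N) * z ^ (n + N)) + (\<Sum>n<N. c n * z ^ n)"
      by (rule suminf_split_initial_segment[OF s])
    \<comment> \<open>Factoring out \<open>z ^ N\<close>, of modulus at most 1, leaves a power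
      series \<open>T\<close> whose coefficients are exactly the square-summable tail.\<close>
    also have "(\<Sum>n. c (n + N) * z ^ (n + N)) = T * z ^ N"
      unfolding T_def power_add mult.assoc [symmetric]
      by (rule suminf_mult2 [symmetric, OF cmod_power_series_le(1)[OF c' z1]])
    finally have "cmod (deriv f z) \<le> cmod (T * z ^ N) + cmod (\<Sum>n<N. c n * z ^ n)"
      by (simp add: norm_triangle_ineq)
    also have "cmod (T * z ^ N) \<le> cmod T"
      using z1 by (simp add: norm_mult norm_power mult_left_le power_le_one)
    also have "cmod (\<Sum>n<N. c n * z ^ n) \<le> M"
      unfolding M_def using z1
      by (intro sum_norm_le) (simp add: norm_mult norm_power mult_left_le power_le_one)
    finally have "?L z \<le> (cmod T + M) * sqrt (1 - (cmod z)\<^sup>2)"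
      using z2 by (intro mult_right_mono) auto
    moreover have "cmod T * sqrt (1 - (cmod z)\<^sup>2) \<le> e/2"
    proof (rule power2_le_imp_le)
      show "(cmod T * sqrt (1 - (cmod z)\<^sup>2))\<^sup>2 \<le> (e/2)\<^sup>2"
        using cmod_power_series_le(2)[OF c' z1] N z2 by (simp add: power_mult_distrib T_def)
    qed (use e in simp)
    ultimately show ?thesis by (simp add: algebra_simps)
  qed
  have "((\<lambda>r. M * sqrt (1 - r\<^sup>2) + e/2) \<longlongrightarrow> M * sqrt (1 - 1\<^sup>2) + e/2) (at_left (1::real))"
    by (intro tendsto_intros)
  then have "((\<lambda>z. M * sqrt (1 - (cmod z)\<^sup>2) + e/2) \<longlongrightarrow> M * sqrt (1 - 1\<^sup>2) + e/2) ?F"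
    by (rule filterlim_compose[OF _ filterlim_filtercomap])
  then have "eventually (\<lambda>z. M * sqrt (1 - (cmod z)\<^sup>2) + e/2 < e) ?F"
    using e by (elim order_tendstoD(2)) auto
  then show "eventually (\<lambda>z. dist (?L z) 0 < e) ?F"
    using eventually_at_left_1_disc
  proof eventually_elim
    case (elim z)
    then show ?case
      using le[of z] by (auto simp: abs_mult abs_square_le_1)
  qed
qed

section \<open>Test functions\<close>

text \<open>The derivative of \<open>f\<close> is the normalised reproducing kernel of the Hardy space at \<open>a\<close>.\<close>

lemma S2_kernel_primitive:
  assumes a: "a \<in> unit_disc"
  obtains f where "f \<in> S2" "S2_norm f = 1"
    "\<And>w. w \<in> unit_disc \<Longrightarrow>
       (f has_field_derivative of_real (sqrt (1 - (cmod a)\<^sup>2)) / (1 - cnj a * w)) (at w)"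
proof -
  define s where "s = sqrt (1 - (cmod a)\<^sup>2)"
  define h where "h w = of_real s / (1 - cnj a * w)" for w
  have a1: "cmod a < 1" and a2: "(cmod a)\<^sup>2 < 1"
    using a by (simp_all add: abs_square_less_1)
  have aw: "cmod (cnj a * w) < 1" if "cmod w < 1" for w
    using mult_strict_mono'[OF a1 that] by (simp add: norm_mult)
  have nz: "1 - cnj a * w \<noteq> 0" if "w \<in> unit_disc" for w
    using aw[of w] that by auto
  have h: "h holomorphic_on unit_disc"
    unfolding h_def by (intro holomorphic_intros) (use nz in auto)
  obtain g where g: "\<And>w. w \<in> unit_disc \<Longrightarrow> (g has_field_derivative h w) (at w within unit_disc)"
    using holomorphic_convex_primitive'[OF convex_ball open_ball h] by blast
  \<comment> \<open>Making the primitive vanish at 0 reduces its \<open>S2\<close> norm to the Hardy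
    norm of \<open>h\<close>, which is 1.\<close>
  define f where "f w = g w - g 0" for w
  have f': "(f has_field_derivative h w) (at w)" if "w \<in> unit_disc" for w
  proof -
    have "(g has_field_derivative h w) (at w)"
      using g[OF that] at_within_open[OF that open_ball] by metis
    then show ?thesis
      unfolding f_def by (auto intro!: derivative_eq_intros)
  qed
  \<comment> \<open>The geometric expansion of \<open>h\<close>. Since \<open>deriv f\<close> and
    \<open>h\<close> agree near 0, its coefficients determine the Taylor coefficients of
    \<open>f\<close>.\<close>
  define H where "H = Abs_fps (\<lambda>n. of_real s * cnj a ^ n)"
  have Hs: "(\<lambda>n. fps_nth H n * w ^ n) sums h w" if "w \<in> unit_disc" for w
  proof -
    have "(\<lambda>n. of_real s * (cnj a * w) ^ n) sums (of_real s * (1 / (1 - cnj a * w)))"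
      by (intro sums_mult geometric_sums aw) (use that in simp)
    then show ?thesis by (simp add: H_def h_def power_mult_distrib mult.assoc)
  qed
  \<comment> \<open>Any nonzero point of the disc would serve: only positivity of the radius is
    wanted.\<close>
  have "fps_conv_radius H \<ge> norm (1/2 :: complex)"
    unfolding fps_conv_radius_def
    by (intro conv_radius_geI sums_summable[OF Hs]) simp
  then have "fps_conv_radius H > 0"
    by (rule less_le_trans [rotated]) simp
  moreover have "eventually (\<lambda>w. w \<in> unit_disc) (nhds 0)"
    by (intro eventually_nhds_in_open) auto
  then have "eventually (\<lambda>w. eval_fps H w = h w) (nhds 0)"
    by eventually_elim (simp add: eval_fps_def sums_unique[OF Hs, symmetric])
  ultimately have "h has_fps_expansion H"
    by (simp add: has_fps_expansion_def)
  moreover have "eventually (\<lambda>w. deriv f w = h w) (nhds 0)"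
    using \<open>eventually (\<lambda>w. w \<in> unit_disc) (nhds 0)\<close>
    by eventually_elim (rule DERIV_imp_deriv[OF f'])
  then have "(deriv ^^ n) (deriv f) 0 = (deriv ^^ n) h 0" for n
    by (rule higher_deriv_cong_ev) simp
  ultimately have coeff: "of_nat (Suc n) * taylor_coeff f (Suc n) = of_real s * cnj a ^ n" for n
    using fps_nth_fps_expansion[of h H n]
    by (simp add: taylor_coeff_def fps_expansion_def funpow_Suc_right H_def del: funpow.simps of_nat_Suc)
  let ?u = "\<lambda>n. (real n)\<^sup>2 * (cmod (taylor_coeff f n))\<^sup>2"
  have "?u (Suc n) = (cmod (of_nat (Suc n) * taylor_coeff f (Suc n)))\<^sup>2" for n
    by (simp add: norm_mult power_mult_distrib del: of_nat_Suc)
  also have "\<dots> n = (1 - (cmod a)\<^sup>2) * ((cmod a)\<^sup>2) ^ n" for n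
    unfolding coeff using a2
    by (simp add: norm_mult norm_power power_mult_distrib s_def power_mult [symmetric] mult.commute)
  finally have u: "?u (Suc n) = (1 - (cmod a)\<^sup>2) * ((cmod a)\<^sup>2) ^ n" for n .
  have "(\<lambda>n. (1 - (cmod a)\<^sup>2) * ((cmod a)\<^sup>2) ^ n) sums ((1 - (cmod a)\<^sup>2) * (1 / (1 - (cmod a)\<^sup>2)))"
    using a2 by (intro sums_mult geometric_sums) simp
  then have "(\<lambda>n. ?u (Suc n)) sums 1"
    unfolding u using a2 by simp
  \<comment> \<open>The shift costs nothing because \<open>?u 0\<close> is 0.\<close>
  then have u1: "?u sums 1"
    using sums_Suc_iff[of ?u 1] by simp
  have "f holomorphic_on unit_disc"
    using f' by (subst holomorphic_on_open[OF open_ball]) blast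
  then have "f \<in> S2"
    using u1 by (simp add: S2_def sums_iff)
  moreover have "S2_norm f = 1"
    using sums_unique[OF u1] by (simp add: S2_norm_def f_def [of 0])
  ultimately show ?thesis
    using that f' unfolding h_def s_def by blast
qed


section \<open>Compact operators and boundary decay\<close>

text \<open>If decay failed, compactness along a bad sequence would give a norm limit
  \<open>g\<close> of a subsequence of images. The weighted derivative of image minus
  \<open>g\<close> is controlled by the norm, and that of \<open>g\<close> decays by
  \<open>S2_deriv_tendsto_0\<close>, a contradiction.\<close>

lemma compact_on_S2_deriv_tendsto_0:
  fixes f :: "complex \<Rightarrow> complex \<Rightarrow> complex"
  assumes T: "compact_on_S2 T"
    and f: "\<And>z. z \<in> unit_disc \<Longrightarrow> f z \<in> S2" "\<And>z. z \<in> unit_disc \<Longrightarrow> S2_norm (f z) \<le> B"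
  shows "((\<lambda>z. cmod (deriv (T (f z)) z) * sqrt (1 - (cmod z)\<^sup>2)) \<longlongrightarrow> 0)
           (filtercomap cmod (at_left 1))" (is "(?L \<longlongrightarrow> 0) ?F")
proof (rule ccontr)
  assume "\<not> ?thesis"
  then obtain e where e: "e > 0" and ne: "\<not> eventually (\<lambda>z. dist (?L z) 0 < e) ?F"
    by (auto simp: tendsto_iff)
  \<comment> \<open>Otherwise a whole annulus next to the circle would satisfy the bound
    \<open>e\<close>, contradicting \<open>ne\<close>.\<close>
  have "\<exists>z. 1 - 1 / Suc (Suc n) < cmod z \<and> cmod z < 1 \<and> e \<le> dist (?L z) 0" for n
  proof (rule ccontr)
    assume *: "\<not> ?thesis"
    have "eventually (\<lambda>r. r \<in> {1 - 1 / Suc (Suc n)<..<1}) (at_left (1::real))"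
      by (rule eventually_at_left_real) simp
    then have "eventually (\<lambda>z. cmod z \<in> {1 - 1 / Suc (Suc n)<..<1}) ?F"
      by (rule eventually_filtercomapI)
    then have "eventually (\<lambda>z. dist (?L z) 0 < e) ?F"
      by eventually_elim (use * in force)
    with ne show False ..
  qed
  then obtain z where z: "\<And>n. 1 - 1 / Suc (Suc n) < cmod (z n)" "\<And>n. cmod (z n) < 1"
      "\<And>n. e \<le> dist (?L (z n)) 0"
    by metis
  have zD: "z n \<in> unit_disc" for n using z(2) by simp
  have "(\<forall>n. f (z n) \<in> S2) \<and> (\<exists>B. \<forall>n. S2_norm (f (z n)) \<le> B)"
    using f zD by blast
  then have "\<exists>g\<in>S2. \<exists>r :: nat \<Rightarrow> nat. strict_mono r \<and>
      (\<lambda>k. S2_norm (\<lambda>w. T (f (z (r k))) w - g w)) \<longlonglongrightarrow> 0"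
    by (rule T[unfolded compact_on_S2_def, THEN conjunct2, THEN spec[of _ "\<lambda>n. f (z n)"], THEN mp])
  then obtain g r where g: "g \<in> S2" and r: "strict_mono r"
    and lim: "(\<lambda>k. S2_norm (\<lambda>w. T (f (z (r k))) w - g w)) \<longlonglongrightarrow> 0"
    by blast
  have lower: "(\<lambda>n. 1 - 1 / real (Suc (Suc n))) \<longlonglongrightarrow> 1"
    using tendsto_diff[OF tendsto_const[of 1] LIMSEQ_Suc[OF LIMSEQ_Suc[OF lim_1_over_n]]] by simp
  have "(\<lambda>n. cmod (z n)) \<longlonglongrightarrow> 1"
    by (rule tendsto_sandwich[OF _ _ lower tendsto_const])
       (rule always_eventually, use z in \<open>simp add: less_imp_le\<close>)+
  \<comment> \<open>The strict bound \<open>cmod (z n) < 1\<close> turns convergence to 1 into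
    convergence from the left.\<close>
  then have "filterlim (\<lambda>n. cmod (z n)) (at_left 1) sequentially"
    using z(2) by (simp add: filterlim_at less_imp_neq)
  then have "filterlim (\<lambda>k. cmod (z (r k))) (at_left 1) sequentially"
    by (rule filterlim_compose[OF _ filterlim_subseq[OF r]])
  then have "filterlim (\<lambda>k. z (r k)) ?F sequentially"
    by (simp add: filterlim_filtercomap_iff o_def)
  from filterlim_compose[OF S2_deriv_tendsto_0[OF g] this]
  have "(\<lambda>k. S2_norm (\<lambda>w. T (f (z (r k))) w - g w) +
          cmod (deriv g (z (r k))) * sqrt (1 - (cmod (z (r k)))\<^sup>2)) \<longlonglongrightarrow> 0 + 0"
    by (rule tendsto_add[OF lim])
  moreover have "e \<le> S2_norm (\<lambda>w. T (f (z (r k))) w - g w) +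
          cmod (deriv g (z (r k))) * sqrt (1 - (cmod (z (r k)))\<^sup>2)" for k
  proof -
    let ?z = "z (r k)" and ?q = "sqrt (1 - (cmod (z (r k)))\<^sup>2)"
    have q: "0 \<le> ?q" using z(2)[of "r k"] by (simp add: abs_square_le_1)
    have Tf: "T (f ?z) \<in> S2"
      using T f(1)[OF zD] by (simp add: compact_on_S2_def)
    have "T (f ?z) field_differentiable at ?z" "g field_differentiable at ?z"
      using S2D(1)[OF Tf] S2D(1)[OF g] zD[of "r k"] by (auto simp: holomorphic_on_imp_differentiable_at)
    then have "deriv (T (f ?z)) ?z = deriv (\<lambda>w. T (f ?z) w - g w) ?z + deriv g ?z"
      by simp
    then have "cmod (deriv (T (f ?z)) ?z) \<le> cmod (deriv (\<lambda>w. T (f ?z) w - g w) ?z) + cmod (deriv g ?z)"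
      by (metis norm_triangle_ineq)
    then have "?L ?z \<le> cmod (deriv (\<lambda>w. T (f ?z) w - g w) ?z) * ?q + cmod (deriv g ?z) * ?q"
      using mult_right_mono[OF _ q] by (simp add: distrib_right [symmetric])
    also have "cmod (deriv (\<lambda>w. T (f ?z) w - g w) ?z) * ?q \<le> S2_norm (\<lambda>w. T (f ?z) w - g w)"
      by (rule S2_deriv_le[OF S2_diff[OF Tf g] zD])
    finally show ?thesis
      using z(3)[of "r k"] q by (simp add: abs_mult)
  qed
  ultimately have "e \<le> 0 + 0"
    by (intro LIMSEQ_le_const) auto
  with e show False by simp
qed

section \<open>Composition operators applied to the test functions\<close>

lemma analytic_self_map_in_disc:
  "analytic_self_map \<phi> \<Longrightarrow> z \<in> unit_disc \<Longrightarrow> \<phi> z \<in> unit_disc"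
  unfolding analytic_self_map_def by blast

lemma analytic_self_map_deriv_comp:
  assumes \<phi>: "analytic_self_map \<phi>" and z: "z \<in> unit_disc"
    and f: "\<And>w. w \<in> unit_disc \<Longrightarrow> (f has_field_derivative h w) (at w)"
  shows "(comp_op \<phi> f has_field_derivative h (\<phi> z) * deriv \<phi> z) (at z)"
proof -
  have "(\<phi> has_field_derivative deriv \<phi> z) (at z)"
    using \<phi> z by (auto simp: analytic_self_map_def intro: holomorphic_derivI[OF _ open_ball])
  then show ?thesis
    unfolding comp_op_def by (rule DERIV_chain2[where g = \<phi>, OF f[OF analytic_self_map_in_disc[OF \<phi> z]]])
qed

text \<open>The operator is tested on the unit-norm kernel primitive at \<open>\<phi> z\<close>, and
  \<open>S2_deriv_le\<close> is applied to its image at \<open>z\<close>.\<close>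

lemma bounded_comp_op_deriv_le:
  assumes \<phi>: "analytic_self_map \<phi>" and bdd: "bounded_on_S2 (comp_op \<phi>)"
  obtains C where "\<And>z. z \<in> unit_disc \<Longrightarrow>
    cmod (deriv \<phi> z) * sqrt (1 - (cmod z)\<^sup>2) / sqrt (1 - (cmod (\<phi> z))\<^sup>2) \<le> C"
proof -
  from bdd obtain C where C: "\<And>f. f \<in> S2 \<Longrightarrow> S2_norm (comp_op \<phi> f) \<le> C * S2_norm f"
    and S2: "\<And>f. f \<in> S2 \<Longrightarrow> comp_op \<phi> f \<in> S2"
    by (auto simp: bounded_on_S2_def)
  have "cmod (deriv \<phi> z) * sqrt (1 - (cmod z)\<^sup>2) / sqrt (1 - (cmod (\<phi> z))\<^sup>2) \<le> C"
    if z: "z \<in> unit_disc" for z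
  proof -
    define a where "a = \<phi> z"
    define s where "s = sqrt (1 - (cmod a)\<^sup>2)"
    have a: "a \<in> unit_disc" using analytic_self_map_in_disc[OF \<phi> z] by (simp add: a_def)
    then have a2: "(cmod a)\<^sup>2 < 1" by (simp add: abs_square_less_1)
    then have s: "s > 0" and s2: "s\<^sup>2 = 1 - (cmod a)\<^sup>2" by (simp_all add: s_def)
    \<comment> \<open>On the diagonal the normalised kernel takes the value \<open>1 / s\<close>,
      which produces the denominator in the claim.\<close>
    have "1 - cnj a * a = of_real (s\<^sup>2)"
      by (simp only: s2 of_real_diff complex_norm_square) (simp add: mult.commute)
    then have k: "of_real s / (1 - cnj a * a) = of_real (1 / s)"
      using s by (simp add: power2_eq_square)
    obtain f where f: "f \<in> S2" "S2_norm f = 1" and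
      f': "\<And>w. w \<in> unit_disc \<Longrightarrow> (f has_field_derivative of_real s / (1 - cnj a * w)) (at w)"
      using S2_kernel_primitive[OF a] unfolding s_def by blast
    have "deriv (comp_op \<phi> f) z = of_real (1 / s) * deriv \<phi> z"
      using DERIV_imp_deriv[OF analytic_self_map_deriv_comp[OF \<phi> z f']] k unfolding a_def by metis
    then have "cmod (deriv \<phi> z) * sqrt (1 - (cmod z)\<^sup>2) / s
               = cmod (deriv (comp_op \<phi> f) z) * sqrt (1 - (cmod z)\<^sup>2)"
      using s by (simp add: norm_mult norm_divide)
    also have "\<dots> \<le> S2_norm (comp_op \<phi> f)"
      by (rule S2_deriv_le[OF S2[OF f(1)] z])
    also have "\<dots> \<le> C"
      using C[OF f(1)] f(2) by simp
    finally show ?thesis by (simp add: s_def a_def)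
  qed
  then show ?thesis by (rule that)
qed

text \<open>Boundary decay for kernel primitives at \<open>a z\<close>, with the derivative of the
  image written out by the chain rule. The base point is left free so that both
  \<open>\<phi>\<close> and \<open>\<psi>\<close> can be inserted.\<close>

lemma compact_comp_op_diff_kernel_tendsto_0:
  assumes \<phi>: "analytic_self_map \<phi>" and \<psi>: "analytic_self_map \<psi>"
    and compact: "compact_on_S2 (\<lambda>f z. comp_op \<phi> f z - comp_op \<psi> f z)"
    and a: "\<And>z. z \<in> unit_disc \<Longrightarrow> a z \<in> unit_disc"
  shows "((\<lambda>z. cmod (deriv \<phi> z / (1 - cnj (a z) * \<phi> z) - deriv \<psi> z / (1 - cnj (a z) * \<psi> z))
             * sqrt (1 - (cmod (a z))\<^sup>2) * sqrt (1 - (cmod z)\<^sup>2)) \<longlongrightarrow> 0)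
           (filtercomap cmod (at_left 1))"
proof -
  define s where "s z = sqrt (1 - (cmod (a z))\<^sup>2)" for z
  have "\<exists>f. f \<in> S2 \<and> S2_norm f = 1 \<and>
      (\<forall>w\<in>unit_disc. (f has_field_derivative of_real (s z) / (1 - cnj (a z) * w)) (at w))"
    if "z \<in> unit_disc" for z
    using S2_kernel_primitive[OF a[OF that]] unfolding s_def by metis
  then obtain f where f: "\<And>z. z \<in> unit_disc \<Longrightarrow> f z \<in> S2" "\<And>z. z \<in> unit_disc \<Longrightarrow> S2_norm (f z) = 1"
    and f': "\<And>z w. z \<in> unit_disc \<Longrightarrow> w \<in> unit_disc \<Longrightarrow>
      (f z has_field_derivative of_real (s z) / (1 - cnj (a z) * w)) (at w)"
    by metis
  have "((\<lambda>z. cmod (deriv (\<lambda>w. comp_op \<phi> (f z) w - comp_op \<psi> (f z) w) z) * sqrt (1 - (cmod z)\<^sup>2)) \<longlongrightarrow> 0)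
           (filtercomap cmod (at_left 1))"
    by (rule compact_on_S2_deriv_tendsto_0[OF compact f(1) eq_refl[OF f(2)]])
  moreover have "cmod (deriv (\<lambda>w. comp_op \<phi> (f z) w - comp_op \<psi> (f z) w) z) =
      cmod (deriv \<phi> z / (1 - cnj (a z) * \<phi> z) - deriv \<psi> z / (1 - cnj (a z) * \<psi> z)) * s z"
    if z: "z \<in> unit_disc" for z
  proof -
    have "0 \<le> s z" using a[OF z] by (simp add: s_def abs_square_le_1)
    moreover have "deriv (\<lambda>w. comp_op \<phi> (f z) w - comp_op \<psi> (f z) w) z =
      (deriv \<phi> z / (1 - cnj (a z) * \<phi> z) - deriv \<psi> z / (1 - cnj (a z) * \<psi> z)) * of_real (s z)"
      using DERIV_imp_deriv[OF DERIV_diff[OF analytic_self_map_deriv_comp[OF \<phi> z f'[OF z]]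
            analytic_self_map_deriv_comp[OF \<psi> z f'[OF z]]]]
      by (simp add: algebra_simps)
    ultimately show ?thesis by (simp add: norm_mult)
  qed
  ultimately show ?thesis
    by (elim Lim_transform_eventually, intro eventually_mono[OF eventually_at_left_1_disc])
       (simp add: s_def)
qed

section \<open>The pseudohyperbolic identity and a real inequality\<close>

text \<open>Rests on |1 - conj(a) b|^2 - |a - b|^2 = (1 - |a|^2)(1 - |b|^2), divided by |1 - conj(a)
  b|^2.\<close>

lemma pseudohyperbolic_dist_square:
  assumes a: "a \<in> unit_disc" and b: "b \<in> unit_disc"
  shows "(pseudohyperbolic_dist a b)\<^sup>2
    = 1 - (sqrt (1 - (cmod a)\<^sup>2) * sqrt (1 - (cmod b)\<^sup>2) / cmod (1 - cnj a * b))\<^sup>2"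
proof -
  have "cmod (cnj a * b) < 1"
    using mult_strict_mono'[of "cmod a" 1 "cmod b" 1] a b by (simp add: norm_mult)
  then have nz: "1 - cnj a * b \<noteq> 0" by auto
  have "(cmod (a - b))\<^sup>2 = (cmod (1 - cnj a * b))\<^sup>2 - (1 - (cmod a)\<^sup>2) * (1 - (cmod b)\<^sup>2)"
    unfolding cmod_power2 by (simp add: algebra_simps power2_eq_square)
  moreover have "(sqrt (1 - (cmod a)\<^sup>2))\<^sup>2 = 1 - (cmod a)\<^sup>2" "(sqrt (1 - (cmod b)\<^sup>2))\<^sup>2 = 1 - (cmod b)\<^sup>2"
    using a b by (simp_all add: abs_square_le_1)
  ultimately show ?thesis
    unfolding pseudohyperbolic_dist_def norm_divide power_divide power_mult_distrib
    using nz by (simp only: diff_divide_distrib) simp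
qed

text \<open>From \<open>r\<^sup>2 * x = (x - s * y) + s * (y - s * x)\<close> and
  \<open>s \<le> 1\<close> one gets \<open>r\<^sup>2 * x \<le> d + e\<close>. The goal has only one
  factor \<open>r\<close>, so it is squared, and the three surplus factors \<open>x\<close> are
  absorbed by \<open>C ^ 3\<close>.\<close>

lemma defect_mult_square_le:
  fixes x y s r d e C :: real
  assumes "0 \<le> x" "0 \<le> s" "0 \<le> r" and r: "r\<^sup>2 = 1 - s\<^sup>2"
    and d: "\<bar>x - s * y\<bar> \<le> d" and e: "\<bar>y - s * x\<bar> \<le> e" and C: "x \<le> C"
  shows "r * x\<^sup>2 \<le> sqrt ((d + e) * C ^ 3)"
proof (rule real_le_rsqrt)
  have "s\<^sup>2 \<le> 1" using r zero_le_power2[of r] by linarith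
  then have "s \<le> 1" using \<open>0 \<le> s\<close> by (simp add: abs_square_le_1)
  have "s * (y - s * x) \<le> s * e"
    using e \<open>0 \<le> s\<close> by (intro mult_left_mono) auto
  also have "\<dots> \<le> e"
    using e \<open>s \<le> 1\<close> by (intro mult_left_le_one_le \<open>0 \<le> s\<close>) auto
  finally have "(x - s * y) + s * (y - s * x) \<le> d + e"
    using d by linarith
  then have "r\<^sup>2 * x \<le> d + e"
    unfolding r by (simp add: algebra_simps power2_eq_square)
  moreover have "x ^ 3 \<le> C ^ 3"
    using C \<open>0 \<le> x\<close> by (rule power_mono)
  ultimately have "(r\<^sup>2 * x) * x ^ 3 \<le> (d + e) * C ^ 3"
    using d e \<open>0 \<le> x\<close> by (intro mult_mono) auto
  then show "(r * x\<^sup>2)\<^sup>2 \<le> (d + e) * C ^ 3"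
    by (simp add: power_mult_distrib power2_eq_square power3_eq_cube mult_ac)
qed

section \<open>Combination of the estimates\<close>

theorem theorem3p4:
  fixes \<phi> \<psi> :: "complex \<Rightarrow> complex" and \<rho> :: "complex \<Rightarrow> real"
  assumes "analytic_self_map \<phi>" and "analytic_self_map \<psi>"
    and "bounded_on_S2 (comp_op \<phi>)" and "bounded_on_S2 (comp_op \<psi>)"
    and "\<And>z. z \<in> unit_disc \<Longrightarrow> \<rho> z = pseudohyperbolic_dist (\<phi> z) (\<psi> z)"
    and "compact_on_S2 (\<lambda>f z. comp_op \<phi> f z - comp_op \<psi> f z)"
  shows "((\<lambda>z. \<rho> z *
            ((cmod (deriv \<phi> z))\<^sup>2 * (1 - (cmod z)\<^sup>2) / (1 - (cmod (\<phi> z))\<^sup>2)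
             + (cmod (deriv \<psi> z))\<^sup>2 * (1 - (cmod z)\<^sup>2) / (1 - (cmod (\<psi> z))\<^sup>2)))
          \<longlongrightarrow> 0) (filtercomap cmod (at_left 1))" (is "(?G \<longlongrightarrow> 0) ?F")
proof -
  define q where "q w = sqrt (1 - (cmod w)\<^sup>2)" for w :: complex
  define x where "x z = cmod (deriv \<phi> z) * q z / q (\<phi> z)" for z
  define y where "y z = cmod (deriv \<psi> z) * q z / q (\<psi> z)" for z
  define s where "s z = q (\<phi> z) * q (\<psi> z) / cmod (1 - cnj (\<phi> z) * \<psi> z)" for z
  \<comment> \<open>\<open>D \<phi>\<close> and \<open>D \<psi>\<close> are the decaying quantities
    for the two base points; they will dominate the defects \<open>x - s * y\<close> and
    \<open>y - s * x\<close>.\<close>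
  define D where "D a z = cmod (deriv \<phi> z / (1 - cnj (a z) * \<phi> z) - deriv \<psi> z / (1 - cnj (a z) * \<psi> z))
     * q (a z) * q z" for a z
  have self: "\<phi> z \<in> unit_disc" "\<psi> z \<in> unit_disc" if "z \<in> unit_disc" for z
    using assms(1,2) that by (blast intro: analytic_self_map_in_disc)+
  have q: "q w > 0" "(q w)\<^sup>2 = 1 - (cmod w)\<^sup>2" if "w \<in> unit_disc" for w
    using that by (auto simp: q_def abs_square_less_1 abs_square_le_1)
  obtain C1 where C1: "\<And>z. z \<in> unit_disc \<Longrightarrow> x z \<le> C1"
    using bounded_comp_op_deriv_le[OF assms(1,3)] unfolding x_def q_def by blast
  obtain C2 where C2: "\<And>z. z \<in> unit_disc \<Longrightarrow> y z \<le> C2"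
    using bounded_comp_op_deriv_le[OF assms(2,4)] unfolding y_def q_def by blast
  have "(D \<phi> \<longlongrightarrow> 0) ?F" "(D \<psi> \<longlongrightarrow> 0) ?F"
    unfolding D_def q_def
    by (rule compact_comp_op_diff_kernel_tendsto_0[OF assms(1,2,6)]; use self in blast)+
  then have "((\<lambda>z. sqrt ((D \<phi> z + D \<psi> z) * C1 ^ 3) + sqrt ((D \<psi> z + D \<phi> z) * C2 ^ 3)) \<longlongrightarrow>
      sqrt ((0 + 0) * C1 ^ 3) + sqrt ((0 + 0) * C2 ^ 3)) ?F"
    by (intro tendsto_intros)
  then have lim: "((\<lambda>z. sqrt ((D \<phi> z + D \<psi> z) * C1 ^ 3) + sqrt ((D \<psi> z + D \<phi> z) * C2 ^ 3)) \<longlongrightarrow> 0) ?F"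
    by simp
  have bound: "\<bar>?G z\<bar> \<le> sqrt ((D \<phi> z + D \<psi> z) * C1 ^ 3) + sqrt ((D \<psi> z + D \<phi> z) * C2 ^ 3)"
    if z: "z \<in> unit_disc" for z
  proof -
    note qz = q[OF z] and q\<phi> = q[OF self(1)[OF z]] and q\<psi> = q[OF self(2)[OF z]]
    have k: "1 - cnj w * w = of_real ((q w)\<^sup>2)" if "w \<in> unit_disc" for w
      by (simp only: q(2)[OF that] of_real_diff complex_norm_square) (simp add: mult.commute)
    have x0: "0 \<le> x z" and y0: "0 \<le> y z" and s0: "0 \<le> s z"
      using qz q\<phi> q\<psi> by (simp_all add: x_def y_def s_def)
    have \<rho>: "0 \<le> \<rho> z" "(\<rho> z)\<^sup>2 = 1 - (s z)\<^sup>2"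
      using pseudohyperbolic_dist_square[OF self[OF z]]
      by (simp_all add: assms(5)[OF z] s_def q_def) (simp add: pseudohyperbolic_dist_def)
    \<comment> \<open>Base point \<open>\<psi> z\<close> produces the conjugate of the denominator
      in \<open>s\<close>; the moduli agree, so the same \<open>s\<close> serves both
      defects.\<close>
    have sym: "cmod (1 - cnj (\<psi> z) * \<phi> z) = cmod (1 - cnj (\<phi> z) * \<psi> z)"
      using complex_mod_cnj[of "1 - cnj (\<psi> z) * \<phi> z"] by (simp add: mult.commute)
    \<comment> \<open>\<open>x z\<close> and \<open>s z * y z\<close> are the weighted moduli of the
      two terms inside \<open>D \<phi> z\<close>, so the reverse triangle inequality bounds their
      difference.\<close>
    have "x z = cmod (deriv \<phi> z / (1 - cnj (\<phi> z) * \<phi> z)) * q (\<phi> z) * q z"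
      using q\<phi>(1) by (simp add: k[OF self(1)[OF z]] x_def norm_divide norm_power power2_eq_square norm_mult)
    moreover have "s z * y z = cmod (deriv \<psi> z / (1 - cnj (\<phi> z) * \<psi> z)) * q (\<phi> z) * q z"
      using q\<psi>(1) by (simp add: y_def s_def norm_divide)
    ultimately have 1: "\<bar>x z - s z * y z\<bar> \<le> D \<phi> z"
      using qz(1) q\<phi>(1) norm_triangle_ineq3
      by (simp add: D_def left_diff_distrib [symmetric] abs_mult)
    have "y z = cmod (deriv \<psi> z / (1 - cnj (\<psi> z) * \<psi> z)) * q (\<psi> z) * q z"
      using q\<psi>(1) by (simp add: k[OF self(2)[OF z]] y_def norm_divide norm_power power2_eq_square norm_mult)
    moreover have "s z * x z = cmod (deriv \<phi> z / (1 - cnj (\<psi> z) * \<phi> z)) * q (\<psi> z) * q z"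
      using q\<phi>(1) by (simp add: x_def s_def norm_divide sym)
    ultimately have 2: "\<bar>y z - s z * x z\<bar> \<le> D \<psi> z"
      using qz(1) q\<psi>(1) norm_triangle_ineq3
      by (subst abs_minus_commute) (simp add: D_def left_diff_distrib [symmetric] abs_mult)
    have "?G z = \<rho> z * (x z)\<^sup>2 + \<rho> z * (y z)\<^sup>2"
      using qz(2) q\<phi>(2) q\<psi>(2) by (simp add: x_def y_def power_divide power_mult_distrib distrib_left)
    moreover have "0 \<le> \<rho> z * (x z)\<^sup>2 + \<rho> z * (y z)\<^sup>2"
      using \<rho>(1) by simp
    \<comment> \<open>The real inequality is used twice, with the roles of \<open>x\<close> and
      \<open>y\<close> exchanged.\<close>
    ultimately show ?thesis
      using defect_mult_square_le[OF x0 s0 \<rho> 1 2 C1[OF z]] defect_mult_square_le[OF y0 s0 \<rho> 2 1 C2[OF z]]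
      by linarith
  qed
  show ?thesis
    by (rule Lim_null_comparison[OF eventually_mono[OF eventually_at_left_1_disc] lim])
       (use bound in simp)
qed

end
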